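(* Let $S=\{(x_j,y_j)\}_{j=1}^n\subseteq\mathbb{R}^d\times\{-1,1\}$ be a dataset, $C>0$, and $K:\mathbb{R}^d\times\mathbb{R}^d\to\mathbb{R}$ a positive definite kernel. Let $\mathcal{A}_{\mathrm{SVM}}$ be a deterministic algorithm for the constrained SVM problem satisfying: for all $I,J\subseteq[n]$, $\operatorname{supp}(\mathcal{A}_{\mathrm{SVM}}(I))\subseteq J\subseteq I$ implies $\mathcal{A}_{\mathrm{SVM}}(I)=\mathcal{A}_{\mathrm{SVM}}(J)$. Let $\mathcal{M}_{\mathrm{all}}=\{\mathcal{A}_{\mathrm{SVM}}(I)\mid I\subseteq[n]\}$ and let $k$ be a positive integer with $k\le|\mathcal{M}_{\mathrm{all}}|$. Run the algorithm EnumSV on $(S,C,K)$ and stop it as soon as $|\mathcal{M}|=k$. Then this eventually happens, and the resulting set $\mathcal{M}_k=\{\alpha^{(1)},\dots,\alpha^{(k)}\}$ satisfies $\mathcal{M}_k\subseteq\mathcal{M}_{\mathrm{all}}$ and consists of the top-$k$ models, i.e. $f(\alpha)\ge f(\beta)$ for all $\alpha\in\mathcal{M}_k$ and $\beta\in\mathcal{M}_{\mathrm{all}}\setminus\mathcal{M}_k$.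
   Context: Notation: $[n]=\{1,\dots,n\}$. For $\alpha\in\mathbb{R}^n$, $\operatorname{supp}(\alpha)=\{j\in[n]\mid\alpha_j\neq0\}$. The objective function is $$f(\alpha)=\sum_{j\in[n]}\alpha_j-\frac12\sum_{i,j\in[n]}\alpha_i\alpha_jy_iy_jK(x_i,x_j).$$ The feasible set (model space) $\mathcal{F}$ is the set of $\alpha\in\mathbb{R}^n$ with $\sum_{j\in[n]}\alpha_jy_j=0$ and $\alpha_j\in[0,C]$ for all $j\in[n]$. Elements of $\mathcal{F}$ are called models. For $I\subseteq[n]$, $\mathcal{F}(I)=\{\alpha\in\mathcal{F}\mid\operatorname{supp}(\alpha)\subseteq I\}$, and $\mathrm{SVM}(I)=\{\alpha\in\mathcal{F}(I)\mid f(\alpha)=\max_{\beta\in\mathcal{F}(I)}f(\beta)\}$ is the set of globally optimal solutions of the constrained SVM problem for $I$. An algorithm for the constrained SVM problem is a deterministic map $\mathcal{A}_{\mathrm{SVM}}:2^{[n]}\to\mathcal{F}$ (with $S,C,K$ fixed) such that $\mathcal{A}_{\mathrm{SVM}}(I)\in\mathrm{SVM}(I)$ for every $I\subseteq[n]$. Algorithm EnumSV. It maintains a priority queue $H$ of triples $(\alpha,I,B)$ with $\alpha\in\mathcal{F}$ and $I,B\subseteq[n]$; extraction removes a triple with maximum key $f(\alpha)$ (ties broken arbitrarily). It also maintains a collection $\mathcal{M}$ of models, ordered by time of insertion; $\alpha^{(i)}$ denotes the $i$-th model inserted into $\mathcal{M}$. 1. Set $H\leftarrow\emptyset$, insert $(\mathcal{A}_{\mathrm{SVM}}([n]),[n],\emptyset)$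 into $H$, and set $\mathcal{M}\leftarrow\emptyset$. 2. While $H\neq\emptyset$: extract a triple $(\alpha,I,B)$ with maximum key from $H$; if $\alpha\notin\mathcal{M}$, insert $\alpha$ into $\mathcal{M}$. Then, for each $j\in\operatorname{supp}(\alpha)\setminus B$ in turn (in any order): set $I'\leftarrow I\setminus\{j\}$, $\alpha'\leftarrow\mathcal{A}_{\mathrm{SVM}}(I')$, insert $(\alpha',I',B)$ into $H$ with the current $B$, and then set $B\leftarrow B\cup\{j\}$. 3. When $H=\emptyset$, return $\mathcal{M}$. *)

theory Defs
  imports "HOL-Analysis.Analysis" "HOL-Library.Multiset"
begin

text \<open>The index set \<open>[n]\<close> is a finite type \<open>'n\<close>, with \<open>n\<close> its cardinality.
  A dataset is an indexed family of points \<open>x j\<close> and labels \<open>y j\<close>; repetitions are allowed.\<close>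

definition supp :: "real ^ 'n \<Rightarrow> 'n set" where
  "supp \<alpha> = {j. \<alpha> $ j \<noteq> 0}"

text \<open>As usual for kernels, positive definite means symmetric with positive semidefinite
  Gram matrices.\<close>

definition positive_definite_kernel :: "('a \<Rightarrow> 'a \<Rightarrow> real) \<Rightarrow> bool" where
  "positive_definite_kernel K \<longleftrightarrow>
     (\<forall>u v. K u v = K v u) \<and>
     (\<forall>(m::nat) (z :: nat \<Rightarrow> 'a) (c :: nat \<Rightarrow> real).
        0 \<le> (\<Sum>i<m. \<Sum>j<m. c i * c j * K (z i) (z j)))"

definition svm_objective ::
  "('n::finite \<Rightarrow> 'a) \<Rightarrow> ('n \<Rightarrow> real) \<Rightarrow> ('a \<Rightarrow> 'a \<Rightarrow> real) \<Rightarrow> real ^ 'n \<Rightarrow> real" where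
  "svm_objective x y K \<alpha> =
     (\<Sum>j\<in>UNIV. \<alpha> $ j)
     - 1 / 2 * (\<Sum>i\<in>UNIV. \<Sum>j\<in>UNIV. \<alpha> $ i * \<alpha> $ j * y i * y j * K (x i) (x j))"

definition svm_models :: "('n::finite \<Rightarrow> real) \<Rightarrow> real \<Rightarrow> (real ^ 'n) set" where
  "svm_models y C = {\<alpha>. (\<Sum>j\<in>UNIV. \<alpha> $ j * y j) = 0 \<and> (\<forall>j. \<alpha> $ j \<in> {0..C})}"

definition svm_models_on :: "('n::finite \<Rightarrow> real) \<Rightarrow> real \<Rightarrow> 'n set \<Rightarrow> (real ^ 'n) set" where
  "svm_models_on y C I = {\<alpha> \<in> svm_models y C. supp \<alpha> \<subseteq> I}"

definition SVM ::
  "('n::finite \<Rightarrow> 'a) \<Rightarrow> ('n \<Rightarrow> real) \<Rightarrow> real \<Rightarrow> ('a \<Rightarrow> 'a \<Rightarrow> real) \<Rightarrow> 'n set \<Rightarrow> (real ^ 'n) set" where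
  "SVM x y C K I =
     {\<alpha> \<in> svm_models_on y C I.
        \<forall>\<beta> \<in> svm_models_on y C I. svm_objective x y K \<beta> \<le> svm_objective x y K \<alpha>}"

definition svm_algorithm ::
  "('n::finite \<Rightarrow> 'a) \<Rightarrow> ('n \<Rightarrow> real) \<Rightarrow> real \<Rightarrow> ('a \<Rightarrow> 'a \<Rightarrow> real) \<Rightarrow> ('n set \<Rightarrow> real ^ 'n) \<Rightarrow> bool" where
  "svm_algorithm x y C K \<A> \<longleftrightarrow> (\<forall>I. \<A> I \<in> SVM x y C K I)"

text \<open>A state consists of the priority queue \<open>H\<close>, a multiset of triples \<open>(\<alpha>, I, B)\<close>, and the
  collection \<open>M\<close>, a list in order of insertion.\<close>

type_synonym 'n enum_state =
  "((real ^ 'n) \<times> 'n set \<times> 'n set) multiset \<times> (real ^ 'n) list"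

definition queue :: "'n enum_state \<Rightarrow> ((real ^ 'n) \<times> 'n set \<times> 'n set) multiset" where
  "queue s = fst s"

definition models :: "'n enum_state \<Rightarrow> (real ^ 'n) list" where
  "models s = snd s"

text \<open>The inner loop, for the order of traversal given by the list argument.\<close>

fun enumsv_branch ::
  "('n set \<Rightarrow> real ^ 'n) \<Rightarrow> 'n set \<Rightarrow> 'n list \<Rightarrow> 'n set \<Rightarrow>
   ((real ^ 'n) \<times> 'n set \<times> 'n set) multiset \<Rightarrow> ((real ^ 'n) \<times> 'n set \<times> 'n set) multiset" where
  "enumsv_branch \<A> I [] B H = H"
| "enumsv_branch \<A> I (j # js) B H =
     enumsv_branch \<A> I js (insert j B) (add_mset (\<A> (I - {j}), I - {j}, B) H)"

text \<open>One iteration of the outer loop. It is nondeterministic in the choice of a triple of maximum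
  key and in the order \<open>js\<close> of the inner loop.\<close>

inductive enumsv_step ::
  "(real ^ 'n \<Rightarrow> real) \<Rightarrow> ('n set \<Rightarrow> real ^ 'n) \<Rightarrow> 'n enum_state \<Rightarrow> 'n enum_state \<Rightarrow> bool"
  for f \<A> where
  "\<lbrakk> (\<alpha>, I, B) \<in># H;
     \<And>\<beta> J D. (\<beta>, J, D) \<in># H \<Longrightarrow> f \<beta> \<le> f \<alpha>;
     distinct js; set js = supp \<alpha> - B \<rbrakk>
   \<Longrightarrow> enumsv_step f \<A> (H, M)
         (enumsv_branch \<A> I js B (H - {#(\<alpha>, I, B)#}),
          if \<alpha> \<in> set M then M else M @ [\<alpha>])"

text \<open>\<open>r t\<close> is the state after \<open>t\<close> iterations; once the queue is empty the state stays constant.\<close>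

definition enumsv_run ::
  "('n::finite \<Rightarrow> 'a) \<Rightarrow> ('n \<Rightarrow> real) \<Rightarrow> ('a \<Rightarrow> 'a \<Rightarrow> real) \<Rightarrow> ('n set \<Rightarrow> real ^ 'n) \<Rightarrow>
   (nat \<Rightarrow> 'n enum_state) \<Rightarrow> bool" where
  "enumsv_run x y K \<A> r \<longleftrightarrow>
     r 0 = ({#(\<A> UNIV, UNIV, {})#}, []) \<and>
     (\<forall>t. if queue (r t) = {#} then r (Suc t) = r t
          else enumsv_step (svm_objective x y K) \<A> (r t) (r (Suc t)))"

lemma enumsv_step_exists:
  fixes s :: "'n::finite enum_state"
  assumes "queue s \<noteq> {#}"
  shows "\<exists>s'. enumsv_step f \<A> s s'"
proof -
  obtain H M where s: "s = (H, M)" by (cases s)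
  let ?F = "(\<lambda>p. f (fst p)) ` set_mset H"
  have "Max ?F \<in> ?F" using assms by (intro Max_in) (auto simp: s queue_def)
  then obtain \<alpha> I B where p: "(\<alpha>, I, B) \<in># H" and m: "Max ?F = f \<alpha>" by fastforce
  have "f \<beta> \<le> f \<alpha>" if "(\<beta>, J, D) \<in># H" for \<beta> J D
    unfolding m[symmetric] using that by (intro Max_ge) force+
  moreover obtain js where "set js = supp \<alpha> - B" "distinct js"
    using finite_distinct_list[of "supp \<alpha> - B"] by auto
  ultimately show ?thesis
    unfolding s using enumsv_step.intros[OF p] by blast
qed

lemma enumsv_run_exists: "\<exists>r. enumsv_run x y K \<A> r"
proof -
  let ?f = "svm_objective x y K"
  define g where "g s = (if queue s = {#} then s else SOME s'. enumsv_step ?f \<A> s s')" for s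
  have "enumsv_step ?f \<A> s (g s)" if "queue s \<noteq> {#}" for s
    using someI_ex[OF enumsv_step_exists[OF that]] that by (simp add: g_def)
  then have "enumsv_run x y K \<A> (\<lambda>t. (g ^^ t) ({#(\<A> UNIV, UNIV, {})#}, []))"
    unfolding enumsv_run_def by (simp add: g_def)
  then show ?thesis by blast
qed

end

theory Submission imports Defs begin

text \<open>A triple \<open>(\<alpha>, I, B)\<close> in the queue stands for the interval of index sets \<open>J\<close> with
  \<open>B \<subseteq> J \<subseteq> I\<close>. When it is extracted, those \<open>J\<close> that contain \<open>supp \<alpha>\<close> have \<open>\<A> J = \<alpha>\<close> by the
  hypothesis on \<open>\<A>\<close>, and any other \<open>J\<close> lies in the interval of the child created for the first
  \<open>j \<in> supp \<alpha> - J\<close> in the order of traversal. Hence every model \<open>\<A> J\<close> is either already in \<open>M\<close> or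
  covered by the queue. As \<open>f (\<A> I)\<close> is monotone in \<open>I\<close>, a covered model has objective at most
  the largest key, and keys are extracted in nonincreasing order. The intervals of the children
  are disjoint and miss \<open>I\<close>, so the total size \<open>\<Sum> 2 ^ card (I - B)\<close> of the intervals decreases.\<close>

definition interval_weight :: "((real ^ 'n) \<times> 'n set \<times> 'n set) multiset \<Rightarrow> nat" where
  "interval_weight H = (\<Sum>(\<alpha>, I, B)\<in>#H. 2 ^ card (I - B))"

definition covers :: "((real ^ 'n) \<times> 'n set \<times> 'n set) multiset \<Rightarrow> 'n set \<Rightarrow> bool" where
  "covers H J \<longleftrightarrow> (\<exists>\<alpha> I B. (\<alpha>, I, B) \<in># H \<and> B \<subseteq> J \<and> J \<subseteq> I)"

lemma enumsv_branch_superset: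
  "p \<in># H \<Longrightarrow> p \<in># enumsv_branch \<A> I js B H"
  by (induction js arbitrary: B H) auto

lemma enumsv_branch_triple:
  assumes "(\<beta>, J, D) \<in># enumsv_branch \<A> I js B H" "distinct js" "set js \<subseteq> I - B" "B \<subseteq> I"
  shows "(\<beta>, J, D) \<in># H \<or> \<beta> = \<A> J \<and> D \<subseteq> J \<and> J \<subseteq> I"
  using assms
proof (induction js arbitrary: B H)
  case (Cons j js)
  have "(\<beta>, J, D) \<in># add_mset (\<A> (I - {j}), I - {j}, B) H \<or> \<beta> = \<A> J \<and> D \<subseteq> J \<and> J \<subseteq> I"
    by (rule Cons.IH[of "insert j B"]) (use Cons.prems in auto)
  then show ?case using Cons.prems by auto
qed simp

text \<open>Let \<open>j\<close> be the first entry of \<open>js\<close> outside \<open>J\<close>.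
  All earlier entries lie in \<open>J\<close>, so the current \<open>B\<close> is still a subset of
  \<open>J\<close> when the child with index set \<open>I - {j}\<close> is created.\<close>

lemma enumsv_branch_covers:
  assumes "B \<subseteq> J" "J \<subseteq> I" "\<not> set js \<subseteq> J"
  shows "covers (enumsv_branch \<A> I js B H) J"
  using assms
proof (induction js arbitrary: B H)
  case (Cons j js)
  show ?case
  proof (cases "j \<in> J")
    case True
    then show ?thesis using Cons by simp
  next
    case False
    have "(\<A> (I - {j}), I - {j}, B) \<in># enumsv_branch \<A> I (j # js) B H"
      by (simp add: enumsv_branch_superset)
    then show ?thesis unfolding covers_def using False Cons.prems by blast
  qed
qed simp

text \<open>Each \<open>j\<close> halves the current interval: the sets without \<open>j\<close> go
  to the child, those containing \<open>j\<close> stay for the rest of the loop. Strictness comes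
  from the interval left over at the end, whose weight is positive.\<close>

lemma interval_weight_branch:
  fixes I :: "'n::finite set"
  assumes "distinct js" "set js \<subseteq> I - B"
  shows "interval_weight (enumsv_branch \<A> I js B H) < interval_weight H + 2 ^ card (I - B)"
  using assms
proof (induction js arbitrary: B H)
  case (Cons j js)
  let ?H = "add_mset (\<A> (I - {j}), I - {j}, B) H"
  have eq: "I - {j} - B = I - insert j B" by auto
  have "I - B = insert j (I - insert j B)" using Cons.prems by auto
  then have card: "card (I - B) = Suc (card (I - insert j B))" by simp
  have "interval_weight (enumsv_branch \<A> I js (insert j B) ?H)
      < interval_weight ?H + 2 ^ card (I - insert j B)"
    by (rule Cons.IH) (use Cons.prems in auto)
  then show ?case unfolding card by (simp add: interval_weight_def eq)
qed simp

text \<open>Shrinking the index set shrinks the feasible set, hence also the maximum.\<close>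

lemma SVM_objective_mono:
  assumes "\<alpha> \<in> SVM x y C K I" "\<beta> \<in> SVM x y C K J" "J \<subseteq> I"
  shows "svm_objective x y K \<beta> \<le> svm_objective x y K \<alpha>"
  using assms unfolding SVM_def svm_models_on_def by blast

text \<open>Isolates the properties of the objective and the solver on which the enumeration
  argument rests.\<close>

locale stable_algorithm =
  fixes f :: "real ^ 'n::finite \<Rightarrow> real" and \<A> :: "'n set \<Rightarrow> real ^ 'n"
  assumes supp_subset: "supp (\<A> I) \<subseteq> I"
    and mono: "J \<subseteq> I \<Longrightarrow> f (\<A> J) \<le> f (\<A> I)"
    and stable: "supp (\<A> I) \<subseteq> J \<Longrightarrow> J \<subseteq> I \<Longrightarrow> \<A> I = \<A> J"
begin

text \<open>The third clause expresses that keys are extracted in nonincreasing order. Together with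
  the fourth it makes the collection a top set at every time, not only at termination.\<close>

definition enum_invariant :: "'n enum_state \<Rightarrow> bool" where
  "enum_invariant s \<longleftrightarrow>
     (\<forall>\<alpha> I B. (\<alpha>, I, B) \<in># queue s \<longrightarrow> \<alpha> = \<A> I \<and> B \<subseteq> I) \<and>
     set (models s) \<subseteq> range \<A> \<and>
     (\<forall>\<alpha> \<in> set (models s). \<forall>\<beta> I B. (\<beta>, I, B) \<in># queue s \<longrightarrow> f \<beta> \<le> f \<alpha>) \<and>
     (\<forall>J. \<A> J \<in> set (models s) \<or> covers (queue s) J)"

lemma enum_invariant_init: "enum_invariant ({#(\<A> UNIV, UNIV, {})#}, [])"
  by (auto simp: enum_invariant_def queue_def models_def covers_def)

lemma enum_invariant_step:
  assumes "enumsv_step f \<A> s s'" "enum_invariant s"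
  shows "enum_invariant s'"
    and "interval_weight (queue s') < interval_weight (queue s)"
    and "card (set (models s')) \<le> Suc (card (set (models s)))"
proof -
  obtain \<alpha> I B H js M where in_H: "(\<alpha>, I, B) \<in># H"
    and max: "\<And>\<beta> J D. (\<beta>, J, D) \<in># H \<Longrightarrow> f \<beta> \<le> f \<alpha>"
    and js: "distinct js" "set js = supp \<alpha> - B"
    and s: "s = (H, M)"
    and s': "s' = (enumsv_branch \<A> I js B (H - {#(\<alpha>, I, B)#}),
                   if \<alpha> \<in> set M then M else M @ [\<alpha>])"
    using assms(1) by (cases rule: enumsv_step.cases) blast
  let ?H = "H - {#(\<alpha>, I, B)#}"
  let ?H' = "enumsv_branch \<A> I js B ?H"
  have triple: "\<beta> = \<A> J \<and> D \<subseteq> J" if "(\<beta>, J, D) \<in># H" for \<beta> J D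
    using assms(2) that by (auto simp: enum_invariant_def s queue_def)
  have M: "set M \<subseteq> range \<A>" "\<And>\<gamma>. \<gamma> \<in> set M \<Longrightarrow> f \<alpha> \<le> f \<gamma>"
    "\<And>J. \<A> J \<in> set M \<or> covers H J"
    using assms(2) in_H by (simp_all add: enum_invariant_def s queue_def models_def) blast
  have \<alpha>: "\<alpha> = \<A> I" "B \<subseteq> I" using triple[OF in_H] by auto
  have js_sub: "set js \<subseteq> I - B" using supp_subset[of I] js \<alpha> by auto
  have models: "set (models s') = insert \<alpha> (set M)" by (auto simp: s' models_def)
  have queue: "queue s' = ?H'" by (simp add: s' queue_def)
  have triple': "\<beta> = \<A> J \<and> D \<subseteq> J \<and> f \<beta> \<le> f \<alpha>" if p: "(\<beta>, J, D) \<in># ?H'" for \<beta> J D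
    using enumsv_branch_triple[OF p js(1) js_sub \<alpha>(2)]
  proof
    assume "(\<beta>, J, D) \<in># ?H"
    then have "(\<beta>, J, D) \<in># H" by (rule in_diffD)
    then show ?thesis using triple max by blast
  next
    assume "\<beta> = \<A> J \<and> D \<subseteq> J \<and> J \<subseteq> I"
    \<comment> \<open>A child solves the problem for a subset of \<open>I\<close>, so its key cannot
      exceed that of the extracted triple.\<close>
    then show ?thesis using mono \<alpha>(1) by blast
  qed
  have cover': "\<A> J \<in> insert \<alpha> (set M) \<or> covers ?H' J" for J
  proof (cases "\<A> J \<in> set M")
    case False
    then obtain \<beta> I' B' where p: "(\<beta>, I', B') \<in># H" "B' \<subseteq> J" "J \<subseteq> I'"
      using M(3)[of J] by (auto simp: covers_def)
    show ?thesis
    proof (cases "(\<beta>, I', B') = (\<alpha>, I, B)")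
      case True
      with p have J: "B \<subseteq> J" "J \<subseteq> I" by auto
      show ?thesis
      proof (cases "set js \<subseteq> J")
        case True
        \<comment> \<open>The support is contained in the union of \<open>B\<close> and
          \<open>set js\<close>, and both are subsets of \<open>J\<close>.\<close>
        then have "supp (\<A> I) \<subseteq> J" using js(2) J \<alpha>(1) by auto
        then show ?thesis using stable J \<alpha>(1) by auto
      next
        case False
        then show ?thesis using enumsv_branch_covers J by blast
      qed
    next
      case False
      then have "(\<beta>, I', B') \<in># ?H'"
        using p(1) by (intro enumsv_branch_superset) (auto simp: in_diff_count)
      then show ?thesis using p by (auto simp: covers_def)
    qed
  qed simp
  show "enum_invariant s'"
    unfolding enum_invariant_def models queue
  proof (intro conjI allI ballI impI)
    fix \<gamma> \<beta> J D assume "\<gamma> \<in> insert \<alpha> (set M)" "(\<beta>, J, D) \<in># ?H'"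
    then show "f \<beta> \<le> f \<gamma>" using triple' M(2) order_trans by blast
  next
    show "insert \<alpha> (set M) \<subseteq> range \<A>" using M(1) \<alpha>(1) by simp
  qed (use triple' cover' in blast)+
  have "interval_weight (add_mset (\<alpha>, I, B) ?H) = interval_weight ?H + 2 ^ card (I - B)"
    by (simp add: interval_weight_def del: insert_DiffM)
  then have "interval_weight H = interval_weight ?H + 2 ^ card (I - B)"
    using in_H by simp
  then show "interval_weight (queue s') < interval_weight (queue s)"
    using interval_weight_branch[OF js(1) js_sub, of \<A> ?H] unfolding queue by (simp add: s queue_def)
  show "card (set (models s')) \<le> Suc (card (set (models s)))"
    unfolding models by (simp add: s models_def card_insert_if)
qed

lemma enum_invariant_top:
  assumes "enum_invariant s" "\<alpha> \<in> set (models s)" "\<beta> \<in> range \<A> - set (models s)"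
  shows "f \<beta> \<le> f \<alpha>"
proof -
  obtain J where J: "\<beta> = \<A> J" "\<A> J \<notin> set (models s)" using assms(3) by auto
  then have "covers (queue s) J" using assms(1) by (auto simp: enum_invariant_def)
  then obtain \<gamma> I B where p: "(\<gamma>, I, B) \<in># queue s" "J \<subseteq> I" by (auto simp: covers_def)
  then have "f \<gamma> \<le> f \<alpha>" "\<gamma> = \<A> I" using assms(1,2) unfolding enum_invariant_def by blast+
  then show ?thesis using mono[OF p(2)] J by simp
qed

lemma enum_invariant_finished:
  assumes "enum_invariant s" "queue s = {#}"
  shows "set (models s) = range \<A>"
  using assms by (auto simp: enum_invariant_def covers_def)

end

theorem mainTheorem2:
  fixes x :: "'n::finite \<Rightarrow> real ^ 'd" and y :: "'n \<Rightarrow> real" and C :: real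
    and K :: "real ^ 'd \<Rightarrow> real ^ 'd \<Rightarrow> real"
    and \<A> :: "'n set \<Rightarrow> real ^ 'n" and k :: nat
    and r :: "nat \<Rightarrow> 'n enum_state"
  assumes "\<And>j. y j \<in> {-1, 1}"
    and "C > 0"
    and "positive_definite_kernel K"
    and "svm_algorithm x y C K \<A>"
    and "\<And>I J. supp (\<A> I) \<subseteq> J \<Longrightarrow> J \<subseteq> I \<Longrightarrow> \<A> I = \<A> J"
    and "0 < k" and "k \<le> card (range \<A>)"
    and "enumsv_run x y K \<A> r"
  shows "\<exists>t. card (set (models (r t))) = k \<and>
             (\<forall>s<t. card (set (models (r s))) \<noteq> k) \<and>
             set (models (r t)) \<subseteq> range \<A> \<and>
             (\<forall>\<alpha> \<in> set (models (r t)). \<forall>\<beta> \<in> range \<A> - set (models (r t)).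
                svm_objective x y K \<alpha> \<ge> svm_objective x y K \<beta>)"
proof -
  let ?f = "svm_objective x y K"
  have alg: "\<A> I \<in> SVM x y C K I" for I
    using assms(4) by (simp add: svm_algorithm_def)
  interpret stable_algorithm ?f \<A>
  proof
    show "supp (\<A> I) \<subseteq> I" for I using alg[of I] by (simp add: SVM_def svm_models_on_def)
  qed (use SVM_objective_mono[OF alg alg] assms(5) in auto)
  have init: "r 0 = ({#(\<A> UNIV, UNIV, {})#}, [])"
    and stop: "\<And>t. queue (r t) = {#} \<Longrightarrow> r (Suc t) = r t"
    and step: "\<And>t. queue (r t) \<noteq> {#} \<Longrightarrow> enumsv_step ?f \<A> (r t) (r (Suc t))"
    using assms(8) unfolding enumsv_run_def by (simp, metis+)
  have inv: "enum_invariant (r t)" for t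
  proof (induction t)
    case 0
    then show ?case using enum_invariant_init by (simp add: init)
  next
    case (Suc t)
    then show ?case using stop step enum_invariant_step(1) by metis
  qed
  have card_Suc: "card (set (models (r (Suc t)))) \<le> Suc (card (set (models (r t))))" for t
    using stop step enum_invariant_step(3)[OF _ inv] by (metis le_SucI order_refl)
  have "\<exists>t. queue (r t) = {#}"
  \<comment> \<open>A queue that never empties would make the weights an infinite strictly
    decreasing sequence of naturals.\<close>
  proof (rule ccontr)
    assume "\<nexists>t. queue (r t) = {#}"
    then have "interval_weight (queue (r (Suc t))) < interval_weight (queue (r t))" for t
      using step enum_invariant_step(2)[OF _ inv] by blast
    then show False
      using wf_no_infinite_down_chainE[OF wf_less_than, of "\<lambda>t. interval_weight (queue (r t))"]
      by auto
  qed
  then obtain T where "set (models (r T)) = range \<A>"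
    using enum_invariant_finished[OF inv] by blast
  then have reached: "k \<le> card (set (models (r T)))" using assms(7) by simp
  \<comment> \<open>The first time with at least \<open>k\<close> models is taken, since the final
    state only guarantees this inequality. Equality holds because the count starts at 0, below
    \<open>k\<close>, and grows by at most one per iteration.\<close>
  define t where "t = (LEAST t. k \<le> card (set (models (r t))))"
  have ge: "k \<le> card (set (models (r t)))" unfolding t_def using reached by (rule LeastI)
  have less: "card (set (models (r s))) < k" if "s < t" for s
    using not_less_Least[OF that[unfolded t_def]] by simp
  have "t \<noteq> 0"
  proof
    assume "t = 0"
    with ge \<open>0 < k\<close> show False by (simp add: init models_def)
  qed
  then obtain u where "t = Suc u" by (cases t) auto
  then have "card (set (models (r t))) = k" using ge less[of u] card_Suc[of u] by simp
  moreover have "set (models (r t)) \<subseteq> range \<A>"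
    using inv[of t] by (simp add: enum_invariant_def)
  moreover have "\<forall>s<t. card (set (models (r s))) \<noteq> k" using less by auto
  ultimately show ?thesis using enum_invariant_top[OF inv] by blast
qed

end
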